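(* Let $(G_n)_{n\ge 0}$ be the sequence of graphs defined in the context. The dimension of the bicycle space of $G_n$ is $\frac{4^{n}-1}{3}$.
   Context: The graphs $G_n$: $G_0$ is the complete graph $K_2$ with its two vertices denoted $X_0,Y_0$. For $n\ge 0$, given $G_n$ with two special vertices $X_n,Y_n$, take four disjoint copies $G_n^1,G_n^2,G_n^3,G_n^4$ of $G_n$, with special vertices $X_n^i,Y_n^i$. Identify $X_n^1$ with $X_n^2$ to form the special vertex $X_{n+1}$ of $G_{n+1}$; identify $Y_n^3$ with $Y_n^4$ to form the special vertex $Y_{n+1}$ of $G_{n+1}$; identify $Y_n^1$ with $X_n^3$ to form a vertex $a$, and $Y_n^2$ with $X_n^4$ to form a vertex $b$; finally add a new edge $e_n$ joining $a$ and $b$. The result is $G_{n+1}$. Bicycle space: for a graph $G$, the bicycle space $\mathcal{B}$ of $G$ is the $\mathbb{F}_2$-subspace of $\mathbb{F}_2^{E(G)}$ given by the intersection of the cycle space of $G$ and the cut space (cocycle space) of $G$; its dimension is taken over $\mathbb{F}_2$. Fact recalled in the paper: $T(G;-1,-1)=(-1)^{|E(G)|}(-2)^{\dim\mathcal{B}}$, where $T(G;x,y)=\sum_{H\subseteq G}(x-1)^{r(G)-r(H)}(y-1)^{n(H)}$ is the Tutte polynomial (sum over spanning subgraphs $H$, with $r(H)=|V(H)|-k(H)$, $n(H)=|E(H)|-|V(H)|+k(H)$, and $k(H)$ the number of components of $H$). *)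

theory Defs
  imports Complex_Main "HOL-Library.Z2" "HOL-Library.Function_Algebras"
begin

section \<open>Finite simple graphs\<close>

record 'v graph =
  verts :: "'v set"
  edges :: "'v set set"

definition map_graph :: "('v \<Rightarrow> 'w) \<Rightarrow> 'v graph \<Rightarrow> 'w graph" where
  "map_graph f G = \<lparr>verts = f ` verts G, edges = (\<lambda>e. f ` e) ` edges G\<rparr>"

definition add_edge :: "'v \<Rightarrow> 'v \<Rightarrow> 'v graph \<Rightarrow> 'v graph" where
  "add_edge u v G = \<lparr>verts = verts G, edges = insert {u, v} (edges G)\<rparr>"

section \<open>The sequence of graphs\<close>

datatype vertex = X0 | Y0 | Copy nat vertex

definition four_copies :: "vertex graph \<Rightarrow> vertex graph" where
  "four_copies G =
     \<lparr>verts = (\<Union>i\<in>{1..4}. verts (map_graph (Copy i) G)),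
      edges = (\<Union>i\<in>{1..4}. edges (map_graph (Copy i) G))\<rparr>"

text \<open>
  Identified vertices are represented by one of their members: the function \<open>glue\<close> below sends
  every vertex of the disjoint union to the chosen representative of its class, and
  the special vertices and the vertices called \<open>a\<close> and \<open>b\<close> are these representatives.
\<close>

primrec special_X :: "nat \<Rightarrow> vertex" where
  "special_X 0 = X0"
| "special_X (Suc n) = Copy 1 (special_X n)"

primrec special_Y :: "nat \<Rightarrow> vertex" where
  "special_Y 0 = Y0"
| "special_Y (Suc n) = Copy 3 (special_Y n)"

definition vertex_a :: "nat \<Rightarrow> vertex" where
  "vertex_a n = Copy 1 (special_Y n)"

definition vertex_b :: "nat \<Rightarrow> vertex" where
  "vertex_b n = Copy 2 (special_Y n)"

definition glue :: "nat \<Rightarrow> vertex \<Rightarrow> vertex" where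
  "glue n v =
     (if v \<in> {Copy 1 (special_X n), Copy 2 (special_X n)} then special_X (Suc n)
      else if v \<in> {Copy 3 (special_Y n), Copy 4 (special_Y n)} then special_Y (Suc n)
      else if v \<in> {Copy 1 (special_Y n), Copy 3 (special_X n)} then vertex_a n
      else if v \<in> {Copy 2 (special_Y n), Copy 4 (special_X n)} then vertex_b n
      else v)"

text \<open>
  Two different copies share at most one vertex after the identifications, and no copy contains
  both \<open>a\<close> and \<open>b\<close>. Hence no parallel edges or loops arise and sets of two-element sets suffice
  as edge sets; \<open>card_edges_graph_seq\<close> below confirms that no edges are merged.
\<close>

primrec graph_seq :: "nat \<Rightarrow> vertex graph" where
  "graph_seq 0 = \<lparr>verts = {X0, Y0}, edges = {{X0, Y0}}\<rparr>"
| "graph_seq (Suc n) =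
     add_edge (vertex_a n) (vertex_b n) (map_graph (glue n) (four_copies (graph_seq n)))"

lemma X_neq_Y: "special_X n \<noteq> special_Y n"
  by (cases n) auto

lemma finite_edges_graph_seq: "finite (edges (graph_seq n))"
  by (induction n) (auto simp: add_edge_def map_graph_def four_copies_def)

lemma special_in_graph_seq: "special_X n \<in> verts (graph_seq n)" "special_Y n \<in> verts (graph_seq n)"
proof (induction n)
  case (Suc n)
  have "glue n (Copy 1 (special_X n)) = special_X (Suc n)"
    "glue n (Copy 3 (special_Y n)) = special_Y (Suc n)"
    using X_neq_Y[of n] by (auto simp: glue_def)
  moreover have "Copy 1 (special_X n) \<in> verts (four_copies (graph_seq n))"
    "Copy 3 (special_Y n) \<in> verts (four_copies (graph_seq n))"
    using Suc by (auto simp: four_copies_def map_graph_def)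
  ultimately show "special_X (Suc n) \<in> verts (graph_seq (Suc n))" "special_Y (Suc n) \<in> verts (graph_seq (Suc n))"
    by (auto simp: add_edge_def map_graph_def simp del: special_X.simps special_Y.simps intro: rev_image_eqI)
qed auto

lemma glue_inj: "glue n (Copy i u) = glue n (Copy i v) \<Longrightarrow> u = v"
  using X_neq_Y[of n] by (auto simp: glue_def vertex_a_def vertex_b_def split: if_splits)

lemma glue_share:
  "i \<noteq> j \<Longrightarrow> glue n (Copy i u) = glue n (Copy j v) \<Longrightarrow> glue n (Copy i u') = glue n (Copy j v') \<Longrightarrow> u = u'"
  using X_neq_Y[of n] by (auto simp: glue_def vertex_a_def vertex_b_def split: if_splits)

lemma glue_ab: "glue n (Copy i u) = vertex_a n \<Longrightarrow> glue n (Copy i v) \<noteq> vertex_b n"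
  using X_neq_Y[of n] by (auto simp: glue_def vertex_a_def vertex_b_def split: if_splits)

lemma edge_graph_seq:
  "e \<in> edges (graph_seq n) \<Longrightarrow>
     \<exists>u v. e = {u, v} \<and> u \<noteq> v \<and> u \<in> verts (graph_seq n) \<and> v \<in> verts (graph_seq n)"
proof (induction n arbitrary: e)
  case 0
  have "e = {X0, Y0}" "X0 \<noteq> Y0" using 0 by simp_all
  then show ?case by auto
next
  case (Suc n)
  from Suc.prems consider "e = {vertex_a n, vertex_b n}"
    | i e' where "i \<in> {1..4}" "e' \<in> edges (graph_seq n)" "e = glue n ` Copy i ` e'"
    by (auto simp: add_edge_def map_graph_def four_copies_def)
  then show ?case
  proof cases
    case 1
    have "vertex_a n = glue n (Copy 1 (special_Y n))" "vertex_b n = glue n (Copy 2 (special_Y n))"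
      using X_neq_Y[of n] by (auto simp: glue_def vertex_a_def vertex_b_def)
    moreover have "Copy i (special_Y n) \<in> verts (four_copies (graph_seq n))" if "i \<in> {1..4}" for i
      using that special_in_graph_seq(2)[of n] by (auto simp: four_copies_def map_graph_def)
    ultimately have "vertex_a n \<in> verts (graph_seq (Suc n))" "vertex_b n \<in> verts (graph_seq (Suc n))"
      by (auto simp: add_edge_def map_graph_def)
    moreover have "vertex_a n \<noteq> vertex_b n"
      by (simp add: vertex_a_def vertex_b_def)
    ultimately show ?thesis using 1 by blast
  next
    case 2
    obtain u v where uv: "e' = {u, v}" "u \<noteq> v" "u \<in> verts (graph_seq n)" "v \<in> verts (graph_seq n)"
      using Suc.IH[OF 2(2)] by blast
    have "glue n (Copy i w) \<in> verts (graph_seq (Suc n))" if "w \<in> verts (graph_seq n)" for w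
    proof -
      have "Copy i w \<in> verts (four_copies (graph_seq n))"
        using that 2(1) by (auto simp: four_copies_def map_graph_def)
      then show ?thesis by (simp add: add_edge_def map_graph_def)
    qed
    moreover have "glue n (Copy i u) \<noteq> glue n (Copy i v)"
      using uv(2) glue_inj by blast
    moreover have "e = {glue n (Copy i u), glue n (Copy i v)}"
      using 2(3) uv(1) by simp
    ultimately show ?thesis using uv(3,4) by blast
  qed
qed

lemma card_edges_graph_seq:
  "card (edges (graph_seq (Suc n))) = 4 * card (edges (graph_seq n)) + 1"
proof -
  define f where "f i e = glue n ` Copy i ` e" for i e
  let ?E = "edges (graph_seq n)"
  have E: "edges (graph_seq (Suc n)) = insert {vertex_a n, vertex_b n} (\<Union>i\<in>{1..4}. f i ` ?E)"
    by (auto simp: add_edge_def map_graph_def four_copies_def f_def image_UN)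
  have inj: "inj_on (f i) ?E" for i
  proof -
    have "inj (\<lambda>v. glue n (Copy i v))" by (meson injI glue_inj)
    then have "inj (\<lambda>e. (\<lambda>v. glue n (Copy i v)) ` e)" by (simp add: inj_on_def inj_image_eq_iff)
    then show ?thesis by (simp add: f_def image_image inj_on_def inj_def)
  qed
  have disj: "f i ` ?E \<inter> f j ` ?E = {}" if "i \<noteq> j" for i j
  proof (rule ccontr)
    assume "f i ` ?E \<inter> f j ` ?E \<noteq> {}"
    then obtain e e' where e: "e \<in> ?E" "f i e = f j e'" by blast
    obtain u v where uv: "e = {u, v}" "u \<noteq> v" using edge_graph_seq[OF e(1)] by blast
    have "glue n (Copy i u) \<in> f j e'" "glue n (Copy i v) \<in> f j e'"
      using e(2)[symmetric] uv(1) by (auto simp: f_def)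
    then obtain u' v' where "glue n (Copy i u) = glue n (Copy j u')"
      "glue n (Copy i v) = glue n (Copy j v')" by (auto simp: f_def)
    then show False using glue_share[OF that] uv(2) by blast
  qed
  have "{vertex_a n, vertex_b n} \<noteq> f i e" for i e
  proof
    assume *: "{vertex_a n, vertex_b n} = f i e"
    have "vertex_a n \<in> f i e" "vertex_b n \<in> f i e"
      by (simp_all flip: *)
    then obtain u v where "vertex_a n = glue n (Copy i u)" "vertex_b n = glue n (Copy i v)"
      by (auto simp: f_def)
    then show False using glue_ab[of n i u v] by simp
  qed
  then have "{vertex_a n, vertex_b n} \<notin> (\<Union>i\<in>{1..4}. f i ` ?E)" by blast
  then have "card (edges (graph_seq (Suc n))) = card (\<Union>i\<in>{1..4}. f i ` ?E) + 1"
    unfolding E by (simp add: finite_edges_graph_seq)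
  also have "card (\<Union>i\<in>{1..4}. f i ` ?E) = (\<Sum>i\<in>{1..4}. card (f i ` ?E))"
    using disj by (intro card_UN_disjoint) (auto simp: finite_edges_graph_seq)
  also have "\<dots> = 4 * card ?E" by (simp add: card_image[OF inj])
  finally show ?thesis .
qed

section \<open>Bicycle space\<close>

interpretation F2: vector_space "\<lambda>(c::bit) (x::'e \<Rightarrow> bit) e. c * x e"
  by unfold_locales (auto simp: fun_eq_iff algebra_simps)

text \<open>The space of binary vectors indexed by the edge set, realised as functions vanishing off it.\<close>

definition edge_space :: "'v graph \<Rightarrow> ('v set \<Rightarrow> bit) set" where
  "edge_space G = {x. \<forall>e. e \<notin> edges G \<longrightarrow> x e = 0}"

definition cycle_space :: "'v graph \<Rightarrow> ('v set \<Rightarrow> bit) set" where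
  "cycle_space G = {x \<in> edge_space G. \<forall>v\<in>verts G. (\<Sum>e\<in>{e \<in> edges G. v \<in> e}. x e) = 0}"

definition cut :: "'v graph \<Rightarrow> 'v set \<Rightarrow> 'v set set" where
  "cut G S = {e \<in> edges G. \<exists>u\<in>S. \<exists>v\<in>verts G - S. e = {u, v}}"

definition cut_space :: "'v graph \<Rightarrow> ('v set \<Rightarrow> bit) set" where
  "cut_space G = {(\<lambda>e. of_bool (e \<in> cut G S)) | S. S \<subseteq> verts G}"

definition bicycle_space :: "'v graph \<Rightarrow> ('v set \<Rightarrow> bit) set" where
  "bicycle_space G = cycle_space G \<inter> cut_space G"

lemma subspace_cycle_space: "F2.subspace (cycle_space G)"
proof (intro F2.subspaceI)
  show "0 \<in> cycle_space G" by (simp add: cycle_space_def edge_space_def)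
next
  fix x y :: "'a set \<Rightarrow> bit" assume xy: "x \<in> cycle_space G" "y \<in> cycle_space G"
  have "(\<Sum>e\<in>A. (x + y) e) = (\<Sum>e\<in>A. x e) + (\<Sum>e\<in>A. y e)" for A
    by (simp only: plus_fun_apply sum.distrib)
  then show "x + y \<in> cycle_space G"
    using xy by (simp add: cycle_space_def edge_space_def)
next
  fix c :: bit and x :: "'a set \<Rightarrow> bit" assume x: "x \<in> cycle_space G"
  have "(\<Sum>e\<in>A. c * x e) = c * (\<Sum>e\<in>A. x e)" for A
    by (simp only: sum_distrib_left)
  then show "(\<lambda>e. c * x e) \<in> cycle_space G"
    using x unfolding cycle_space_def edge_space_def by (simp only: mem_Collect_eq) simp
qed

lemma subspace_cut_space:
  assumes "\<And>e. e \<in> edges G \<Longrightarrow> \<exists>u v. e = {u, v} \<and> u \<in> verts G \<and> v \<in> verts G"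
  shows "F2.subspace (cut_space G)"
proof (intro F2.subspaceI)
  have "(\<lambda>e. of_bool (e \<in> cut G {}) :: bit) \<in> cut_space G"
    unfolding cut_space_def by blast
  then show "0 \<in> cut_space G"
    by (simp add: cut_def zero_fun_def)
next
  fix x y :: "'a set \<Rightarrow> bit" assume "x \<in> cut_space G" "y \<in> cut_space G"
  then obtain S T where ST: "S \<subseteq> verts G" "T \<subseteq> verts G"
    and x: "x = (\<lambda>e. of_bool (e \<in> cut G S))" and y: "y = (\<lambda>e. of_bool (e \<in> cut G T))"
    by (auto simp: cut_space_def)
  define U where "U = (S - T) \<union> (T - S)"
  have "e \<in> cut G U \<longleftrightarrow> (e \<in> cut G S) \<noteq> (e \<in> cut G T)" for e
  proof (cases "e \<in> edges G")
    case True
    then obtain u v where e: "e = {u, v}" "u \<in> verts G" "v \<in> verts G" using assms by blast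
    have "e \<in> cut G W \<longleftrightarrow> (u \<in> W) \<noteq> (v \<in> W)" for W
      using True e by (auto simp: cut_def doubleton_eq_iff)
    then show ?thesis by (auto simp: U_def)
  qed (simp add: cut_def)
  then have "x + y = (\<lambda>e. of_bool (e \<in> cut G U))"
    by (auto simp: x y fun_eq_iff)
  moreover have "U \<subseteq> verts G" using ST by (auto simp: U_def)
  ultimately show "x + y \<in> cut_space G"
    unfolding cut_space_def by blast
next
  fix c :: bit and x :: "'a set \<Rightarrow> bit" assume x: "x \<in> cut_space G"
  have "(\<lambda>e. of_bool (e \<in> cut G {}) :: bit) \<in> cut_space G"
    unfolding cut_space_def by blast
  then show "(\<lambda>e. c * x e) \<in> cut_space G"
    proof (cases "c = 0")
    case False
    then have "(\<lambda>e. c * x e) = x" by (simp only: bit_not_zero_iff mult_1_left simp_thms)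
    then show ?thesis using x by simp
  qed (simp add: cut_def)
qed

lemma subspace_bicycle_space_graph_seq: "F2.subspace (bicycle_space (graph_seq n))"
  unfolding bicycle_space_def
  using edge_graph_seq[of _ n]
  by (intro F2.subspace_inter subspace_cycle_space subspace_cut_space) blast

end

theory Submission
  imports Defs
begin

text \<open>
  Over $\mathbb{F}_2$ the bicycles of a connected graph are the coboundaries of the functions
  killed by the Laplacian, taken modulo constants.  Regard \<open>G\<^sub>n\<close> as an electrical network with
  terminals \<open>X\<^sub>n\<close> and \<open>Y\<^sub>n\<close>.  If a function is harmonic at all other vertices and takes
  the values \<open>x\<close>, \<open>y\<close> at the terminals, then its Laplacian at either terminal
  is \<open>x + y\<close>: every \<open>G\<^sub>n\<close> behaves like a single edge.  Hence in \<open>G\<^sub>n\<^sub>+\<^sub>1\<close> harmonicity at \<open>a\<close> and at \<open>b\<close>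
  both amount to \<open>f a + f b = x + y\<close>, which leaves \<open>f a\<close> free.  So the number
  of such functions is \<open>2 ^ k\<^sub>n\<close> with \<open>k\<^sub>0 = 0\<close> and \<open>k\<^sub>n\<^sub>+\<^sub>1 = 4 k\<^sub>n + 1\<close>.
\<close>

declare add_bit_eq_xor [simp del] mult_bit_eq_and [simp del]

section \<open>Counting vectors in spaces over the two-element field\<close>

text \<open>A new independent vector \<open>a\<close> doubles the span: as the only scalars are 0
  and 1, the new span is the old one together with its translate by \<open>a\<close>, and the two
  are disjoint because \<open>a\<close> is not in the old span.\<close>

lemma card_F2_span:
  fixes S :: "('e \<Rightarrow> bit) set"
  assumes "finite S" "F2.independent S"
  shows "finite (F2.span S) \<and> card (F2.span S) = 2 ^ card S"
  using assms
proof (induction S rule: finite_induct)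
  case (insert a S)
  let ?V = "F2.span S"
  have ind: "F2.independent S" and a: "a \<notin> ?V"
    using insert.prems insert.hyps(2) by (simp_all add: F2.independent_insert)
  have fin: "finite ?V" and card: "card ?V = 2 ^ card S"
    using insert.IH[OF ind] by blast+
  have eq: "F2.span (insert a S) = ?V \<union> (+) a ` ?V"
  proof (intro set_eqI iffI)
    fix x assume "x \<in> F2.span (insert a S)"
    then obtain k where k: "x - (\<lambda>e. k * a e) \<in> ?V" by (auto simp: F2.span_insert)
    show "x \<in> ?V \<union> (+) a ` ?V"
    proof (cases "k = 0")
      case True
      then have "x - (\<lambda>e. k * a e) = x" by (simp add: fun_eq_iff)
      then show ?thesis using k by (metis UnI1)
    next
      case False
      then have "x = a + (x - (\<lambda>e. k * a e))" by (simp add: fun_eq_iff)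
      then show ?thesis using k by blast
    qed
  next
    fix x assume "x \<in> ?V \<union> (+) a ` ?V"
    then show "x \<in> F2.span (insert a S)"
      by (auto intro: F2.span_add F2.span_base F2.span_mono[THEN subsetD, OF subset_insertI])
  qed
  have "?V \<inter> (+) a ` ?V = {}"
    using a F2.span_add_eq2 by blast
  then show ?case
    using fin card insert.hyps by (simp add: eq card_Un_disjoint card_image)
qed simp

text \<open>Reduces the computation of a dimension to counting elements.\<close>

lemma card_F2_subspace:
  fixes V :: "('e \<Rightarrow> bit) set"
  assumes "F2.subspace V" "finite V"
  shows "card V = 2 ^ F2.dim V"
proof -
  obtain B where B: "B \<subseteq> V" "F2.independent B" "V \<subseteq> F2.span B" "card B = F2.dim V"
    using F2.basis_exists by blast
  have "F2.span B = V"
    using B(1,3) F2.span_minimal[OF _ assms(1)] by blast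
  then show ?thesis
    using card_F2_span[of B] B assms(2) finite_subset by metis
qed

section \<open>Coboundaries and functions harmonic off the terminals\<close>

text \<open>No orientation of the edge is needed, since signs vanish in characteristic 2.\<close>

definition coboundary :: "('v \<Rightarrow> bit) \<Rightarrow> 'v set \<Rightarrow> bit" where
  "coboundary f e = (\<Sum>u\<in>e. f u)"

definition laplacian :: "'v graph \<Rightarrow> ('v \<Rightarrow> bit) \<Rightarrow> 'v \<Rightarrow> bit" where
  "laplacian G f v = (\<Sum>e\<in>{e \<in> edges G. v \<in> e}. coboundary f e)"

text \<open>The condition outside the vertex set gives every function on the vertices exactly one
  representative, so that counting makes sense.\<close>

definition potentials :: "nat \<Rightarrow> bit \<Rightarrow> bit \<Rightarrow> (vertex \<Rightarrow> bit) set" where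
  "potentials n x y =
     {f. (\<forall>v. v \<notin> verts (graph_seq n) \<longrightarrow> f v = 0) \<and> f (special_X n) = x \<and> f (special_Y n) = y \<and>
         (\<forall>v\<in>verts (graph_seq n) - {special_X n, special_Y n}. laplacian (graph_seq n) f v = 0)}"

section \<open>The four copies inside the next graph\<close>

text \<open>Inclusion of the \<open>i\<close>-th copy into the glued graph;
  \<open>f \<circ> embed n i\<close> is the restriction of \<open>f\<close> to that copy.\<close>

definition embed :: "nat \<Rightarrow> nat \<Rightarrow> vertex \<Rightarrow> vertex" where
  "embed n i v = glue n (Copy i v)"

lemma inj_embed: "inj (embed n i)"
  unfolding embed_def by (meson injI glue_inj)

lemma embed_special:
  "embed n 1 (special_X n) = special_X (Suc n)" "embed n 2 (special_X n) = special_X (Suc n)"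
  "embed n 3 (special_Y n) = special_Y (Suc n)" "embed n 4 (special_Y n) = special_Y (Suc n)"
  "embed n 1 (special_Y n) = vertex_a n" "embed n 3 (special_X n) = vertex_a n"
  "embed n 2 (special_Y n) = vertex_b n" "embed n 4 (special_X n) = vertex_b n"
  using X_neq_Y[of n] by (auto simp: embed_def glue_def vertex_a_def vertex_b_def)

lemma embed_nonspecial:
  "w \<notin> {special_X n, special_Y n} \<Longrightarrow> embed n i w = Copy i w"
  by (auto simp: embed_def glue_def)

lemma embed_eq_Copy_iff:
  "w \<notin> {special_X n, special_Y n} \<Longrightarrow> embed n j u = Copy i w \<longleftrightarrow> j = i \<and> u = w"
  by (auto simp: embed_def glue_def vertex_a_def vertex_b_def)

lemma atLeastAtMost_1_4: "{1..4} = {1, 2, 3, 4::nat}"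
  by auto

lemma verts_Suc: "verts (graph_seq (Suc n)) = (\<Union>i\<in>{1..4}. embed n i ` verts (graph_seq n))"
  by (auto simp: add_edge_def map_graph_def four_copies_def embed_def image_UN image_image)

lemma edges_Suc:
  "edges (graph_seq (Suc n)) =
     insert {vertex_a n, vertex_b n} (\<Union>i\<in>{1..4}. (`) (embed n i) ` edges (graph_seq n))"
  by (auto simp: add_edge_def map_graph_def four_copies_def embed_def image_UN image_image)

declare graph_seq.simps(2) [simp del] One_nat_def [simp del]

text \<open>The image of a nonspecial vertex has only one preimage under all embeddings together,
  and special vertices belong to the graph anyway.\<close>

lemma embed_mem_verts_iff:
  assumes "i \<in> {1..4}"
  shows "embed n i w \<in> verts (graph_seq (Suc n)) \<longleftrightarrow> w \<in> verts (graph_seq n)"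
proof
  assume *: "embed n i w \<in> verts (graph_seq (Suc n))"
  show "w \<in> verts (graph_seq n)"
  proof (cases "w \<in> {special_X n, special_Y n}")
    case False
    then have "embed n j u = embed n i w \<longleftrightarrow> j = i \<and> u = w" for j u
      using embed_eq_Copy_iff embed_nonspecial by metis
    with * show ?thesis unfolding verts_Suc by (smt (verit) UN_iff imageE)
  qed (use special_in_graph_seq in auto)
qed (use assms verts_Suc in blast)

text \<open>Distinct copies share at most one vertex, whereas an edge has two ends.\<close>

lemma embed_edges_disjoint:
  assumes "i \<noteq> j"
  shows "(`) (embed n i) ` edges (graph_seq n) \<inter> (`) (embed n j) ` edges (graph_seq n) = {}"
proof (rule ccontr)
  assume "\<not> ?thesis"
  then obtain e e' where e: "e \<in> edges (graph_seq n)" "embed n i ` e = embed n j ` e'" by blast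
  obtain u v where uv: "e = {u, v}" "u \<noteq> v" using edge_graph_seq[OF e(1)] by blast
  have "embed n i u \<in> embed n j ` e'" "embed n i v \<in> embed n j ` e'"
    using e(2)[symmetric] uv(1) by auto
  then show False using glue_share[OF assms] uv(2) unfolding embed_def by blast
qed

text \<open>No copy contains both ends of the new edge.\<close>

lemma new_edge_not_embedded: "{vertex_a n, vertex_b n} \<noteq> embed n i ` e"
proof
  assume *: "{vertex_a n, vertex_b n} = embed n i ` e"
  have "vertex_a n \<in> embed n i ` e" "vertex_b n \<in> embed n i ` e"
    by (simp_all flip: *)
  then show False using glue_ab[of n i] unfolding embed_def by (metis imageE)
qed

lemma coboundary_embed: "coboundary f (embed n i ` e) = coboundary (f \<circ> embed n i) e"
  unfolding coboundary_def by (simp add: sum.reindex inj_on_subset[OF inj_embed])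

section \<open>The Laplacian of the glued graph\<close>

lemma laplacian_Suc:
  "laplacian (graph_seq (Suc n)) f v =
     (if v \<in> {vertex_a n, vertex_b n} then f (vertex_a n) + f (vertex_b n) else 0) +
     (\<Sum>i\<in>{1..4}. \<Sum>e\<in>{e \<in> edges (graph_seq n). v \<in> embed n i ` e}. coboundary (f \<circ> embed n i) e)"
proof -
  let ?E = "edges (graph_seq n)"
  \<comment> \<open>\<open>h\<close> moves the incidence test from the index set into the summand,
    so that the sum can be split and reindexed over whole edge sets.\<close>
  define h where "h e = (if v \<in> e then coboundary f e else 0)" for e
  have ab: "vertex_a n \<noteq> vertex_b n" by (simp add: vertex_a_def vertex_b_def)
  have "laplacian (graph_seq (Suc n)) f v = (\<Sum>e\<in>edges (graph_seq (Suc n)). h e)"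
    unfolding laplacian_def h_def
    by (rule sum.inter_filter[OF finite_edges_graph_seq])
  also have "\<dots> = h {vertex_a n, vertex_b n} + (\<Sum>e\<in>(\<Union>i\<in>{1..4}. (`) (embed n i) ` ?E). h e)"
    unfolding edges_Suc using new_edge_not_embedded
    by (intro sum.insert) (auto simp: finite_edges_graph_seq)
  also have "(\<Sum>e\<in>(\<Union>i\<in>{1..4}. (`) (embed n i) ` ?E). h e) =
      (\<Sum>i\<in>{1..4}. \<Sum>e\<in>(`) (embed n i) ` ?E. h e)"
    using embed_edges_disjoint
    by (intro sum.UNION_disjoint) (auto simp: finite_edges_graph_seq)
  also have "\<dots> = (\<Sum>i\<in>{1..4}. \<Sum>e\<in>?E. h (embed n i ` e))"
    by (intro sum.cong refl sum.reindex_cong[where l = "(`) (embed n _)"])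
      (auto simp: inj_on_def inj_image_eq_iff[OF inj_embed])
  also have "\<dots> = (\<Sum>i\<in>{1..4}. \<Sum>e\<in>{e \<in> ?E. v \<in> embed n i ` e}. coboundary (f \<circ> embed n i) e)"
    unfolding h_def coboundary_embed
    by (intro sum.cong refl sum.inter_filter[symmetric] finite_edges_graph_seq)
  finally show ?thesis using ab by (simp add: h_def coboundary_def)
qed

lemma laplacian_copy:
  "(\<Sum>e\<in>{e \<in> edges (graph_seq n). embed n i w \<in> embed n i ` e}. coboundary f e) =
     laplacian (graph_seq n) f w"
  unfolding laplacian_def by (simp add: inj_image_mem_iff[OF inj_embed])

lemma laplacian_other_copy:
  assumes "v \<notin> range (embed n i)"
  shows "(\<Sum>e\<in>{e \<in> edges (graph_seq n). v \<in> embed n i ` e}. coboundary f e) = 0"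
proof -
  have "{e \<in> edges (graph_seq n). v \<in> embed n i ` e} = {}" using assms by blast
  then show ?thesis by (simp only: sum.empty)
qed

text \<open>Each glued vertex belongs to exactly two of the four copies; the other two contribute
  nothing to \<open>laplacian_Suc\<close> there.\<close>

lemma special_notin_range_embed:
  "special_X (Suc n) \<notin> range (embed n 3)" "special_X (Suc n) \<notin> range (embed n 4)"
  "special_Y (Suc n) \<notin> range (embed n 1)" "special_Y (Suc n) \<notin> range (embed n 2)"
  "vertex_a n \<notin> range (embed n 2)" "vertex_a n \<notin> range (embed n 4)"
  "vertex_b n \<notin> range (embed n 1)" "vertex_b n \<notin> range (embed n 3)"
  using X_neq_Y[of n] by (auto simp: embed_def glue_def vertex_a_def vertex_b_def)

lemma special_Suc_neq:
  "special_X (Suc n) \<noteq> vertex_a n" "special_X (Suc n) \<noteq> vertex_b n"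
  "special_Y (Suc n) \<noteq> vertex_a n" "special_Y (Suc n) \<noteq> vertex_b n"
  "vertex_a n \<noteq> special_X (Suc n)" "vertex_a n \<noteq> special_Y (Suc n)"
  "vertex_b n \<noteq> special_X (Suc n)" "vertex_b n \<noteq> special_Y (Suc n)"
  using X_neq_Y[of n] by (auto simp: vertex_a_def vertex_b_def)

declare special_X.simps(2) [simp del] special_Y.simps(2) [simp del]

lemma laplacian_Suc_special:
  fixes f n
  defines "L \<equiv> laplacian (graph_seq (Suc n)) f"
    and "l i \<equiv> laplacian (graph_seq n) (f \<circ> embed n i)"
  shows "L (special_X (Suc n)) = l 1 (special_X n) + l 2 (special_X n)"
    and "L (special_Y (Suc n)) = l 3 (special_Y n) + l 4 (special_Y n)"
    and "L (vertex_a n) = f (vertex_a n) + f (vertex_b n) + l 1 (special_Y n) + l 3 (special_X n)"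
    and "L (vertex_b n) = f (vertex_a n) + f (vertex_b n) + l 2 (special_Y n) + l 4 (special_X n)"
proof -
  note copies = laplacian_copy[where n = n and i = 1] laplacian_copy[where n = n and i = 2]
    laplacian_copy[where n = n and i = 3] laplacian_copy[where n = n and i = 4]
  note terminals = copies[where w = "special_X n", unfolded embed_special]
    copies[where w = "special_Y n", unfolded embed_special]
  show "L (special_X (Suc n)) = l 1 (special_X n) + l 2 (special_X n)"
    using terminals special_Suc_neq special_notin_range_embed
    by (simp add: L_def l_def laplacian_Suc atLeastAtMost_1_4 laplacian_other_copy)
  show "L (special_Y (Suc n)) = l 3 (special_Y n) + l 4 (special_Y n)"
    using terminals special_Suc_neq special_notin_range_embed
    by (simp add: L_def l_def laplacian_Suc atLeastAtMost_1_4 laplacian_other_copy)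
  show "L (vertex_a n) = f (vertex_a n) + f (vertex_b n) + l 1 (special_Y n) + l 3 (special_X n)"
    using terminals special_Suc_neq special_notin_range_embed
    by (simp add: L_def l_def laplacian_Suc atLeastAtMost_1_4 laplacian_other_copy add.assoc)
  show "L (vertex_b n) = f (vertex_a n) + f (vertex_b n) + l 2 (special_Y n) + l 4 (special_X n)"
    using terminals special_Suc_neq special_notin_range_embed
    by (simp add: L_def l_def laplacian_Suc atLeastAtMost_1_4 laplacian_other_copy add.assoc)
qed

text \<open>Such a vertex lies in one copy only and is not an end of the new edge, so all its
  incident edges come from that copy.\<close>

lemma laplacian_Suc_nonspecial:
  assumes "w \<notin> {special_X n, special_Y n}" "i \<in> {1..4}"
  shows "laplacian (graph_seq (Suc n)) f (embed n i w) = laplacian (graph_seq n) (f \<circ> embed n i) w"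
proof -
  have v: "embed n i w = Copy i w" by (rule embed_nonspecial[OF assms(1)])
  have "Copy i w \<notin> {vertex_a n, vertex_b n}"
    using assms(1) by (auto simp: vertex_a_def vertex_b_def)
  moreover have "Copy i w \<notin> range (embed n j)" if "j \<noteq> i" for j
    using embed_eq_Copy_iff[OF assms(1)] that by (metis rangeE)
  then have "(\<Sum>e\<in>{e \<in> edges (graph_seq n). Copy i w \<in> embed n j ` e}. coboundary (f \<circ> embed n j) e) =
      (if j = i then laplacian (graph_seq n) (f \<circ> embed n i) w else 0)" for j
    using laplacian_other_copy laplacian_copy[where n = n and i = i and w = w] v by auto
  ultimately show ?thesis
    using assms(2) by (simp add: v laplacian_Suc)
qed

section \<open>The network behaves like a single edge\<close>

text \<open>Interior vertices of a copy stay interior and keep their incident edges, so harmonicity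
  is inherited; the terminal values are those of \<open>f\<close> at the glued vertices.\<close>

lemma potentials_copies:
  assumes "f \<in> potentials (Suc n) x y"
  shows "f \<circ> embed n 1 \<in> potentials n x (f (vertex_a n))"
    and "f \<circ> embed n 2 \<in> potentials n x (f (vertex_b n))"
    and "f \<circ> embed n 3 \<in> potentials n (f (vertex_a n)) y"
    and "f \<circ> embed n 4 \<in> potentials n (f (vertex_b n)) y"
proof -
  have f: "\<And>v. v \<notin> verts (graph_seq (Suc n)) \<Longrightarrow> f v = 0"
    "f (special_X (Suc n)) = x" "f (special_Y (Suc n)) = y"
    "\<And>v. v \<in> verts (graph_seq (Suc n)) \<Longrightarrow> v \<noteq> special_X (Suc n) \<Longrightarrow> v \<noteq> special_Y (Suc n) \<Longrightarrow>
       laplacian (graph_seq (Suc n)) f v = 0"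
    using assms unfolding potentials_def by blast+
  have lap: "laplacian (graph_seq n) (f \<circ> embed n i) w = 0"
    if i: "i \<in> {1..4}" and w: "w \<in> verts (graph_seq n) - {special_X n, special_Y n}" for i w
  proof -
    have "embed n i w \<in> verts (graph_seq (Suc n))"
      using w embed_mem_verts_iff[OF i] by blast
    moreover have "embed n i w = Copy i w"
      using w by (intro embed_nonspecial) blast
    then have "embed n i w \<noteq> special_X (Suc n)" "embed n i w \<noteq> special_Y (Suc n)"
      using w by (auto simp: special_X.simps special_Y.simps)
    ultimately show ?thesis
      using f(4) w laplacian_Suc_nonspecial[OF _ i] by (metis DiffD2)
  qed
  have supp: "(f \<circ> embed n i) w = 0" if "i \<in> {1..4}" "w \<notin> verts (graph_seq n)" for i w
    using f(1) embed_mem_verts_iff[OF that(1)] that(2) by simp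
  have pot: "f \<circ> embed n i \<in> potentials n (f (embed n i (special_X n))) (f (embed n i (special_Y n)))"
    if "i \<in> {1..4}" for i
    unfolding potentials_def using supp[OF that] lap[OF that] by simp
  show "f \<circ> embed n 1 \<in> potentials n x (f (vertex_a n))"
    and "f \<circ> embed n 2 \<in> potentials n x (f (vertex_b n))"
    and "f \<circ> embed n 3 \<in> potentials n (f (vertex_a n)) y"
    and "f \<circ> embed n 4 \<in> potentials n (f (vertex_b n)) y"
    using pot[of 1] pot[of 2] pot[of 3] pot[of 4]
    unfolding embed_special f(2,3) by simp_all
qed

lemma coboundary_doubleton: "u \<noteq> v \<Longrightarrow> coboundary f {u, v} = f u + f v"
  by (simp add: coboundary_def)

lemma laplacian_terminal:
  assumes "f \<in> potentials n x y"
  shows "laplacian (graph_seq n) f (special_X n) = x + y"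
    and "laplacian (graph_seq n) f (special_Y n) = x + y"
proof -
  have "laplacian (graph_seq n) f (special_X n) = x + y \<and>
      laplacian (graph_seq n) f (special_Y n) = x + y"
    using assms
  proof (induction n arbitrary: f x y)
    case 0
    have "{e. e = {X0, Y0} \<and> v \<in> e} = {{X0, Y0}}" if "v = X0 \<or> v = Y0" for v
      using that by blast
    then show ?case
      using 0 by (simp add: potentials_def laplacian_def coboundary_doubleton)
  next
    case (Suc n)
    let ?p = "f (vertex_a n)" and ?q = "f (vertex_b n)"
    note terminals = Suc.IH[OF potentials_copies(1)[OF Suc.prems]] Suc.IH[OF potentials_copies(2)[OF Suc.prems]]
      Suc.IH[OF potentials_copies(3)[OF Suc.prems]] Suc.IH[OF potentials_copies(4)[OF Suc.prems]]
    have "vertex_a n \<in> verts (graph_seq (Suc n))"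
      using embed_mem_verts_iff[of 1 n "special_Y n"] special_in_graph_seq
      unfolding embed_special by simp
    then have "laplacian (graph_seq (Suc n)) f (vertex_a n) = 0"
      using Suc.prems special_Suc_neq(5,6)[of n] unfolding potentials_def by blast
    \<comment> \<open>Copies 1 and 3 meet at \<open>vertex_a n\<close> and act, by induction, as
      edges with end values \<open>x\<close>, \<open>?p\<close> and \<open>?p\<close>,
      \<open>y\<close>.\<close>
    then have "?p + ?q + (x + ?p) + (?p + y) = 0"
      using terminals by (simp add: laplacian_Suc_special)
    then have "?p + ?q = x + y"
      by (cases x; cases y; cases ?p; cases ?q) simp_all
    \<comment> \<open>The left sides are the Laplacians at the two terminals, each collected from
      the two copies meeting there.\<close>
    moreover have "(x + ?p) + (x + ?q) = ?p + ?q" "(?p + y) + (?q + y) = ?p + ?q"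
      by (cases x; cases y; cases ?p; cases ?q; simp)+
    ultimately show ?case
      unfolding laplacian_Suc_special using terminals by metis
  qed
  then show "laplacian (graph_seq n) f (special_X n) = x + y"
    and "laplacian (graph_seq n) f (special_Y n) = x + y" by blast+
qed

section \<open>Recursive structure and number of the harmonic functions\<close>

text \<open>Harmonicity forces the value \<open>x + y + f (vertex_a n)\<close> at
  \<open>vertex_b n\<close>, so \<open>f (vertex_a n)\<close> is the only free value at a glued
  vertex.\<close>

lemma potentials_Suc_iff:
  "f \<in> potentials (Suc n) x y \<longleftrightarrow>
     (\<forall>v. v \<notin> verts (graph_seq (Suc n)) \<longrightarrow> f v = 0) \<and>
     f \<circ> embed n 1 \<in> potentials n x (f (vertex_a n)) \<and>
     f \<circ> embed n 2 \<in> potentials n x (x + y + f (vertex_a n)) \<and>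
     f \<circ> embed n 3 \<in> potentials n (f (vertex_a n)) y \<and>
     f \<circ> embed n 4 \<in> potentials n (x + y + f (vertex_a n)) y"
  (is "?l \<longleftrightarrow> ?r")
proof
  let ?p = "f (vertex_a n)" and ?q = "f (vertex_b n)"
  assume l: ?l
  note copies = potentials_copies[OF l]
  \<comment> \<open>Copies 1 and 2 give this value; comparison with \<open>x + y\<close>, the value
    for the whole network, determines \<open>?q\<close>.\<close>
  have "laplacian (graph_seq (Suc n)) f (special_X (Suc n)) = (x + ?p) + (x + ?q)"
    unfolding laplacian_Suc_special using laplacian_terminal copies by metis
  then have "(x + ?p) + (x + ?q) = x + y"
    using laplacian_terminal(1)[OF l] by simp
  then have "?q = x + y + ?p"
    by (cases x; cases y; cases ?p; cases ?q) simp_all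
  moreover have "\<forall>v. v \<notin> verts (graph_seq (Suc n)) \<longrightarrow> f v = 0"
    using l unfolding potentials_def by blast
  ultimately show ?r using copies by simp
next
  let ?p = "f (vertex_a n)"
  assume r: ?r
  then have c: "f \<circ> embed n 1 \<in> potentials n x ?p" "f \<circ> embed n 2 \<in> potentials n x (x + y + ?p)"
    "f \<circ> embed n 3 \<in> potentials n ?p y" "f \<circ> embed n 4 \<in> potentials n (x + y + ?p) y"
    by blast+
  have "(f \<circ> embed n 1) (special_X n) = x" "(f \<circ> embed n 2) (special_Y n) = x + y + ?p"
    "(f \<circ> embed n 3) (special_Y n) = y"
    using c unfolding potentials_def by blast+
  then have vals: "f (special_X (Suc n)) = x" "f (vertex_b n) = x + y + ?p" "f (special_Y (Suc n)) = y"
    unfolding comp_def embed_special by blast+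
  have lap: "laplacian (graph_seq (Suc n)) f v = 0"
    if v: "v \<in> verts (graph_seq (Suc n))" "v \<noteq> special_X (Suc n)" "v \<noteq> special_Y (Suc n)" for v
  proof -
    obtain i w where i: "i \<in> {1..4}" and w: "w \<in> verts (graph_seq n)" "v = embed n i w"
      using v(1) unfolding verts_Suc by blast
    show ?thesis
    proof (cases "w \<in> {special_X n, special_Y n}")
      case False
      have "laplacian (graph_seq n) (f \<circ> embed n i) w = 0"
        using i c False w(1) unfolding atLeastAtMost_1_4 potentials_def by blast
      then show ?thesis
        using laplacian_Suc_nonspecial[OF False i] w(2) by simp
    next
      case True
      then have "v = vertex_a n \<or> v = vertex_b n"
        using i w(2) v(2,3) embed_special[of n] unfolding atLeastAtMost_1_4 by auto
      \<comment> \<open>Each of \<open>x\<close>, \<open>y\<close>, \<open>?p\<close> occurs an even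
        number of times in this sum and in the next, so both vanish.\<close>
      moreover have "laplacian (graph_seq (Suc n)) f (vertex_a n) = ?p + (x + y + ?p) + (x + ?p) + (?p + y)"
        unfolding laplacian_Suc_special vals using laplacian_terminal c by metis
      moreover have "laplacian (graph_seq (Suc n)) f (vertex_b n) =
          ?p + (x + y + ?p) + (x + (x + y + ?p)) + ((x + y + ?p) + y)"
        unfolding laplacian_Suc_special vals using laplacian_terminal c by metis
      ultimately show ?thesis
        by (cases x; cases y; cases ?p) auto
    qed
  qed
  show ?l
    unfolding potentials_def using r vals lap by blast
qed

text \<open>
  The exceptional cases discard the members of identified pairs that are not representatives:
  they are not vertices of \<open>graph_seq (Suc n)\<close>.
\<close>

fun patch :: "nat \<Rightarrow> (nat \<Rightarrow> vertex \<Rightarrow> bit) \<Rightarrow> vertex \<Rightarrow> bit" where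
  "patch n F (Copy i w) =
     (if i \<in> {1..4} \<and> embed n i w = Copy i w then F i w else 0)"
| "patch n F v = 0"

text \<open>The equations between the \<open>F i\<close> express agreement on the four identified
  pairs, so it does not matter that \<open>patch\<close> reads a glued vertex only in the copy of
  its representative.\<close>

lemma patch_embed:
  assumes "F 1 (special_X n) = F 2 (special_X n)" "F 3 (special_Y n) = F 4 (special_Y n)"
    "F 1 (special_Y n) = F 3 (special_X n)" "F 2 (special_Y n) = F 4 (special_X n)"
    and "i \<in> {1..4}"
  shows "patch n F \<circ> embed n i = F i"
proof
  fix w
  show "(patch n F \<circ> embed n i) w = F i w"
  proof (cases "w \<in> {special_X n, special_Y n}")
    case True
    have "patch n F (special_X (Suc n)) = F 1 (special_X n)"
      "patch n F (special_Y (Suc n)) = F 3 (special_Y n)"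
      "patch n F (vertex_a n) = F 1 (special_Y n)"
      "patch n F (vertex_b n) = F 2 (special_Y n)"
      using embed_special[of n] by (simp_all add: vertex_a_def vertex_b_def special_X.simps special_Y.simps)
    then show ?thesis
      using True assms embed_special[of n] unfolding atLeastAtMost_1_4
      by auto
  next
    case False
    then show ?thesis using embed_nonspecial[OF False, of i] assms(5) by simp
  qed
qed

lemma patch_outside:
  assumes "\<And>i w. i \<in> {1..4} \<Longrightarrow> w \<notin> verts (graph_seq n) \<Longrightarrow> F i w = 0"
    and "v \<notin> verts (graph_seq (Suc n))"
  shows "patch n F v = 0"
proof (cases v)
  case (Copy i w)
  then show ?thesis using assms embed_mem_verts_iff[of i n w] by auto
qed simp_all

lemma eq_if_copies_eq:
  assumes "\<And>v. v \<notin> verts (graph_seq (Suc n)) \<Longrightarrow> f v = g v"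
    and "\<And>i. i \<in> {1..4} \<Longrightarrow> f \<circ> embed n i = g \<circ> embed n i"
  shows "f = g"
proof
  fix v
  show "f v = g v"
  proof (cases "v \<in> verts (graph_seq (Suc n))")
    case True
    then obtain i w where "i \<in> {1..4}" "v = embed n i w" unfolding verts_Suc by blast
    then show ?thesis using fun_cong[OF assms(2), of i w] by simp
  qed (rule assms(1))
qed

text \<open>Once \<open>p\<close> is chosen, the restrictions to the four copies can be chosen
  independently; the inverse map is \<open>patch\<close>.\<close>

lemma bij_betw_potentials_Suc:
  "bij_betw (\<lambda>f. (f (vertex_a n), f \<circ> embed n 1, f \<circ> embed n 2, f \<circ> embed n 3, f \<circ> embed n 4))
     (potentials (Suc n) x y)
     (SIGMA p:UNIV. potentials n x p \<times> potentials n x (x + y + p) \<times>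
        potentials n p y \<times> potentials n (x + y + p) y)"
  (is "bij_betw ?R ?A ?B")
proof (rule bij_betw_imageI)
  show "inj_on ?R ?A"
  proof (rule inj_onI)
    fix f g assume fg: "f \<in> ?A" "g \<in> ?A" "?R f = ?R g"
    show "f = g"
    proof (rule eq_if_copies_eq)
      show "f v = g v" if "v \<notin> verts (graph_seq (Suc n))" for v
        using fg(1,2) that unfolding potentials_Suc_iff by simp
      show "f \<circ> embed n i = g \<circ> embed n i" if "i \<in> {1..4}" for i
        using fg(3) that unfolding atLeastAtMost_1_4 by auto
    qed
  qed
  show "?R ` ?A = ?B"
  proof (intro equalityI subsetI)
    fix t assume "t \<in> ?R ` ?A"
    then show "t \<in> ?B" by (auto simp: potentials_Suc_iff)
  next
    fix t assume "t \<in> ?B"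
    then obtain p f1 f2 f3 f4 where t: "t = (p, f1, f2, f3, f4)"
      and f: "f1 \<in> potentials n x p" "f2 \<in> potentials n x (x + y + p)"
        "f3 \<in> potentials n p y" "f4 \<in> potentials n (x + y + p) y"
      by auto
    define F where "F i = (if i = 1 then f1 else if i = 2 then f2 else if i = 3 then f3 else f4)"
      for i :: nat
    have F: "F 1 = f1" "F 2 = f2" "F 3 = f3" "F 4 = f4" by (simp_all add: F_def)
    \<comment> \<open>Agreement on the identified pairs is automatic: the common values are
      \<open>x\<close>, \<open>y\<close>, \<open>p\<close> and \<open>x + y + p\<close>.\<close>
    have e: "patch n F \<circ> embed n i = F i" if "i \<in> {1..4}" for i
      using f that by (intro patch_embed) (simp_all add: F potentials_def)
    have "(patch n F \<circ> embed n 1) (special_Y n) = p"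
      using f(1) by (subst e) (simp_all add: F potentials_def)
    then have p: "patch n F (vertex_a n) = p"
      by (simp only: comp_apply embed_special)
    have "patch n F v = 0" if "v \<notin> verts (graph_seq (Suc n))" for v
      using that f by (intro patch_outside) (auto simp: F_def potentials_def)
    then have "patch n F \<in> ?A"
      using f e[of 1] e[of 2] e[of 3] e[of 4] unfolding potentials_Suc_iff p F by simp
    moreover have "?R (patch n F) = t"
      using e[of 1] e[of 2] e[of 3] e[of 4] unfolding t p F by simp
    ultimately show "t \<in> ?R ` ?A" by blast
  qed
qed

lemma UNIV_bit: "(UNIV :: bit set) = {0, 1}"
  using bit.exhaust by auto

text \<open>The choice of \<open>p\<close> contributes a factor 2 and each copy the previous count,
  whatever its terminal values; hence the exponent \<open>k\<close> becomes
  \<open>4 * k + 1\<close>.\<close>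

lemma card_potentials: "card (potentials n x y) = 2 ^ (\<Sum>i<n. 4 ^ i)"
proof (induction n arbitrary: x y)
  case 0
  \<comment> \<open>A single edge has no interior vertex, so the terminal values determine the
    function.\<close>
  have "potentials 0 x y = {\<lambda>v. if v = X0 then x else if v = Y0 then y else 0}"
    by (auto simp: potentials_def fun_eq_iff)
  then show ?case by simp
next
  case (Suc n)
  let ?N = "2 ^ (\<Sum>i<n. 4 ^ i) :: nat"
  \<comment> \<open>Infinite sets have cardinality 0, so a power of 2 as cardinality implies
    finiteness.\<close>
  have fin: "finite (potentials n u v)" for u v
    by (rule card_ge_0_finite) (simp add: Suc.IH)
  have "card (potentials (Suc n) x y) = (\<Sum>p\<in>(UNIV :: bit set). ?N * (?N * (?N * ?N)))"
    unfolding bij_betw_same_card[OF bij_betw_potentials_Suc]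
    using fin by (subst card_SigmaI) (simp_all add: UNIV_bit card_cartesian_product Suc.IH)
  also have "\<dots> = 2 * ?N ^ 4"
    by (simp add: UNIV_bit power4_eq_xxxx mult.assoc)
  also have "\<dots> = 2 ^ (\<Sum>i<Suc n. 4 ^ i)"
    unfolding sum.lessThan_Suc_shift by (simp add: sum_distrib_left mult.commute power_add flip: power_mult)
  finally show ?case .
qed

section \<open>Bicycles as coboundaries of harmonic functions\<close>

text \<open>Cutting off outside the edge set places the coboundary in
  \<open>edge_space\<close>.\<close>

definition edge_coboundary :: "nat \<Rightarrow> (vertex \<Rightarrow> bit) \<Rightarrow> vertex set \<Rightarrow> bit" where
  "edge_coboundary n f e = (if e \<in> edges (graph_seq n) then coboundary f e else 0)"

lemma edge_coboundary_in_cycle_space: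
  "edge_coboundary n f \<in> cycle_space (graph_seq n) \<longleftrightarrow>
     (\<forall>v\<in>verts (graph_seq n). laplacian (graph_seq n) f v = 0)"
proof -
  have "(\<Sum>e\<in>{e \<in> edges (graph_seq n). v \<in> e}. edge_coboundary n f e) =
      laplacian (graph_seq n) f v" for v
    unfolding laplacian_def by (intro sum.cong) (auto simp: edge_coboundary_def)
  then show ?thesis
    by (simp add: cycle_space_def edge_space_def edge_coboundary_def)
qed

text \<open>An edge crosses the cut iff exactly one of its ends lies in \<open>S\<close>, that is,
  iff the indicator of \<open>S\<close> sums to 1 over its ends.\<close>

lemma indicator_cut:
  assumes "S \<subseteq> verts (graph_seq n)"
  shows "(\<lambda>e. of_bool (e \<in> cut (graph_seq n) S)) = edge_coboundary n (\<lambda>v. of_bool (v \<in> S))"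
proof
  fix e
  show "of_bool (e \<in> cut (graph_seq n) S) = edge_coboundary n (\<lambda>v. of_bool (v \<in> S)) e"
  proof (cases "e \<in> edges (graph_seq n)")
    case True
    then obtain u v where e: "e = {u, v}" "u \<noteq> v" "u \<in> verts (graph_seq n)" "v \<in> verts (graph_seq n)"
      using edge_graph_seq by blast
    then have "e \<in> cut (graph_seq n) S \<longleftrightarrow> (u \<in> S) \<noteq> (v \<in> S)"
      using True by (auto simp: cut_def doubleton_eq_iff)
    then show ?thesis
      using True e by (auto simp: edge_coboundary_def coboundary_doubleton)
  qed (simp add: cut_def edge_coboundary_def)
qed

text \<open>Functions to \<open>bit\<close> supported on the vertices are precisely the indicators
  of vertex sets.\<close>

lemma cut_space_eq_coboundaries:
  "cut_space (graph_seq n) = edge_coboundary n ` {f. \<forall>v. v \<notin> verts (graph_seq n) \<longrightarrow> f v = 0}"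
proof (intro equalityI subsetI)
  fix c assume "c \<in> cut_space (graph_seq n)"
  then obtain S where S: "S \<subseteq> verts (graph_seq n)" "c = (\<lambda>e. of_bool (e \<in> cut (graph_seq n) S))"
    unfolding cut_space_def by blast
  then show "c \<in> edge_coboundary n ` {f. \<forall>v. v \<notin> verts (graph_seq n) \<longrightarrow> f v = 0}"
    unfolding S(2) indicator_cut[OF S(1)] by (intro imageI) auto
next
  fix c assume "c \<in> edge_coboundary n ` {f. \<forall>v. v \<notin> verts (graph_seq n) \<longrightarrow> f v = 0}"
  then obtain f where f: "\<And>v. v \<notin> verts (graph_seq n) \<Longrightarrow> f v = 0" "c = edge_coboundary n f"
    by blast
  let ?S = "{v. f v \<noteq> 0}"
  have S: "?S \<subseteq> verts (graph_seq n)" using f(1) by blast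
  have "f = (\<lambda>v. of_bool (v \<in> ?S))" by (auto simp: fun_eq_iff)
  then have "c = (\<lambda>e. of_bool (e \<in> cut (graph_seq n) ?S))"
    using indicator_cut[OF S] f(2) by metis
  then show "c \<in> cut_space (graph_seq n)"
    using S unfolding cut_space_def by blast
qed

text \<open>This is connectedness of the graph: the kernel of the coboundary map consists of
  constants. Copies 1 and 2 carry the value at the X terminal to \<open>vertex_a n\<close> and
  \<open>vertex_b n\<close>, from where copies 3 and 4 take it over.\<close>

lemma constant_if_coboundary_0:
  assumes "\<And>e. e \<in> edges (graph_seq n) \<Longrightarrow> coboundary h e = 0" "v \<in> verts (graph_seq n)"
  shows "h v = h (special_X n)"
  using assms
proof (induction n arbitrary: h v)
  case 0
  have "h X0 + h Y0 = 0"
    using "0.prems"(1)[of "{X0, Y0}"] by (simp add: coboundary_doubleton)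
  then show ?case using "0.prems"(2) by (cases "h X0"; cases "h Y0") auto
next
  case (Suc n)
  have copy: "h (embed n i w) = h (embed n i (special_X n))"
    if "i \<in> {1..4}" "w \<in> verts (graph_seq n)" for i w
  proof -
    have "coboundary (h \<circ> embed n i) e = 0" if "e \<in> edges (graph_seq n)" for e
      unfolding coboundary_embed[symmetric]
      using that \<open>i \<in> {1..4}\<close> by (intro Suc.prems(1)) (unfold edges_Suc, blast)
    from Suc.IH[OF this that(2)] show ?thesis by simp
  qed
  have "h (vertex_a n) = h (special_X (Suc n))" "h (vertex_b n) = h (special_X (Suc n))"
    using copy[of 1 "special_Y n"] copy[of 2 "special_Y n"] special_in_graph_seq(2)
    unfolding embed_special by simp_all
  then have "h (embed n i (special_X n)) = h (special_X (Suc n))" if "i \<in> {1..4}" for i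
    using that embed_special[of n] unfolding atLeastAtMost_1_4 by auto
  then show ?case
    using copy Suc.prems(2) unfolding verts_Suc by auto
qed

lemma coboundary_add: "coboundary (\<lambda>v. f v + g v) e = coboundary f e + coboundary g e"
  by (simp add: coboundary_def sum.distrib)

lemma bit_add_eq_0_iff: "x + y = 0 \<longleftrightarrow> x = y" for x y :: bit
  by (cases x; cases y) simp_all

text \<open>The terminal value 0 at \<open>special_X n\<close> selects one function from each class
  modulo constants.\<close>

lemma bij_betw_potentials_bicycle_space:
  "bij_betw (edge_coboundary n) (potentials n 0 0) (bicycle_space (graph_seq n))"
proof (rule bij_betw_imageI)
  let ?V = "verts (graph_seq n)"
  show "inj_on (edge_coboundary n) (potentials n 0 0)"
  proof (rule inj_onI)
    fix f g assume fg: "f \<in> potentials n 0 0" "g \<in> potentials n 0 0"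
      "edge_coboundary n f = edge_coboundary n g"
    have "coboundary (\<lambda>v. f v + g v) e = 0" if "e \<in> edges (graph_seq n)" for e
      using fun_cong[OF fg(3), of e] that
      by (simp add: edge_coboundary_def coboundary_add bit_add_eq_0_iff)
    from constant_if_coboundary_0[OF this]
    have "f v + g v = 0" if "v \<in> ?V" for v
      using fg(1,2) that by (simp add: potentials_def)
    moreover have "f v = g v" if "v \<notin> ?V" for v
      using fg(1,2) that by (simp add: potentials_def)
    ultimately show "f = g"
      by (auto simp: fun_eq_iff bit_add_eq_0_iff)
  qed
  show "edge_coboundary n ` potentials n 0 0 = bicycle_space (graph_seq n)"
  proof (intro equalityI subsetI)
    fix c assume "c \<in> edge_coboundary n ` potentials n 0 0"
    then obtain f where f: "f \<in> potentials n 0 0" and c: "c = edge_coboundary n f" by blast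
    \<comment> \<open>With both terminal values 0, \<open>laplacian_terminal\<close> gives
      harmonicity at the terminals too.\<close>
    have "laplacian (graph_seq n) f v = 0" if "v \<in> ?V" for v
      using f laplacian_terminal[OF f] that unfolding potentials_def by fastforce
    then have "c \<in> cycle_space (graph_seq n)"
      by (simp add: c edge_coboundary_in_cycle_space)
    moreover have "c \<in> cut_space (graph_seq n)"
      using f by (auto simp: c cut_space_eq_coboundaries potentials_def)
    ultimately show "c \<in> bicycle_space (graph_seq n)"
      by (simp add: bicycle_space_def)
  next
    fix c assume c: "c \<in> bicycle_space (graph_seq n)"
    then obtain f where f: "c = edge_coboundary n f"
      unfolding bicycle_space_def cut_space_eq_coboundaries by blast
    \<comment> \<open>Adding the constant \<open>f (special_X n)\<close> on the vertices leaves the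
      coboundary unchanged and makes the value at \<open>special_X n\<close> zero.\<close>
    define g where "g v = (if v \<in> ?V then f v + f (special_X n) else 0)" for v
    have "coboundary g e = coboundary f e" if e: "e \<in> edges (graph_seq n)" for e
    proof -
      obtain u v where "e = {u, v}" "u \<noteq> v" "u \<in> ?V" "v \<in> ?V"
        using edge_graph_seq[OF e] by blast
      then show ?thesis
        by (cases "f (special_X n)") (simp_all add: coboundary_doubleton g_def)
    qed
    then have cg: "c = edge_coboundary n g"
      by (auto simp: f edge_coboundary_def)
    have lap: "laplacian (graph_seq n) g v = 0" if "v \<in> ?V" for v
      using c that unfolding cg bicycle_space_def
      by (simp add: edge_coboundary_in_cycle_space)
    have g: "g (special_X n) = 0"
      by (cases "f (special_X n)") (simp_all add: g_def)
    have "g \<in> potentials n 0 (g (special_Y n))"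
      using lap g by (simp add: potentials_def g_def)
    \<comment> \<open>The Laplacian at \<open>special_X n\<close> equals
      \<open>0 + g (special_Y n)\<close>, and it vanishes because \<open>c\<close> is a
      cycle.\<close>
    moreover from laplacian_terminal(1)[OF this] have "g (special_Y n) = 0"
      using lap[OF special_in_graph_seq(1)] by simp
    ultimately show "c \<in> edge_coboundary n ` potentials n 0 0"
      unfolding cg by simp
  qed
qed

theorem corollary6:
  fixes n :: nat
  shows "real (F2.dim (bicycle_space (graph_seq n))) = (4 ^ n - 1) / 3"
proof -
  have card: "card (bicycle_space (graph_seq n)) = 2 ^ (\<Sum>i<n. 4 ^ i)"
    using bij_betw_same_card[OF bij_betw_potentials_bicycle_space] card_potentials by metis
  then have "finite (bicycle_space (graph_seq n))"
    by (intro card_ge_0_finite) simp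
  from card_F2_subspace[OF subspace_bicycle_space_graph_seq this]
  have "F2.dim (bicycle_space (graph_seq n)) = (\<Sum>i<n. 4 ^ i)"
    using card by simp
  then show ?thesis
    by (simp add: geometric_sum)
qed

end
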